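(* Let $R(t)\in \mathrm{SO}(3)$, $\Omega(t)\in\mathbb{R}^3$, $v(t)\in\mathbb{R}^3$ ($t\ge 0$), $g>0$ and $m_{\mathcal I}\in S^2$ be as in the context, with $m_{\mathcal I}$ and $e_3$ non-collinear, $|v(t)|\le v_{max}$ and $|\Omega(t)|\le\Omega_{max}$ for all $t\ge 0$. Let $D(t)=M(t)^\top M(t)\in\mathbb{R}^{6\times 6}$ be the matrix defined in the context, for either one of the two parametrizations ($\tilde\lambda$ or $\bar\lambda$). Assume that there exists $\rho>0$ such that $|R_{3,3}(t)|\ge\rho$ for all $t\ge 0$. Then there exists $\mu>0$ such that $$D(t)\ \ge\ \mu I_6\qquad \forall t\ge 0$$ in each of the following cases: (1) Motion along the vertical direction: $v(t)\times e_3=0$ for all $t\ge 0$; (2) Pure translation: $\Omega(t)=0$ for all $t\ge 0$; (3) Slow motion such that $v_{max}\,\Omega_{max}\le \dfrac{g\rho^2}{\sqrt 6}$.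
   Context: Notation. $\{e_1,e_2,e_3\}$ is the canonical basis of $\mathbb{R}^3$; $[u]_\times$ is the skew-symmetric matrix with $[u]_\times w=u\times w$ for all $w\in\mathbb{R}^3$; $I_n$ is the $n\times n$ identity matrix; $S^2$ is the unit sphere of $\mathbb{R}^3$; $R_{i,j}$ is the $(i,j)$ entry of $R$; $|\cdot|$ is the Euclidean norm; for symmetric matrices, $A\ge B$ means that $A-B$ is positive semidefinite. System. $R(t)\in\mathrm{SO}(3)$ is the attitude of a vehicle (rotation of a body-fixed frame relative to an inertial frame), and satisfies $\dot R=R[\Omega]_\times$, where $\Omega(t)\in\mathbb{R}^3$ is the angular velocity in body coordinates. $v(t)\in\mathbb{R}^3$ is the linear velocity expressed in the inertial frame, and $\dot v$ is its time derivative. All functions of time are defined for $t\ge 0$ and regular enough for the expressions below to make sense ($\Omega$ continuous, $v$ continuously differentiable). $g>0$ is the gravity constant. $m_{\mathcal I}\in S^2$ is a constant unit vector (normalized Earth's magnetic field in the inertial frame), not collinear with $e_3$. Standing assumption: there are positive numbers $v_{max},\Omega_{max}$ such that $|v(t)|\le v_{max}$ and $|\Omega(t)|\le\Omega_{max}$ for all $t\ge 0$. Matrices. Let $$\Delta=\begin{bmatrix} e_1^\top\\ e_2^\top\\ e_3^\top R\end{bmatrix}\in\mathbb{R}^{3\times 3}.$$ For the $\tilde\lambda$ parametrization, $$A^\star=\begin{bmatrix}0_{3\times3}&0_{3\times3}\\ gR^\top[e_3]_\times & -[\Omega]_\times\end{bmatrix},\qquad C^\star=\begin{bmatrix}\begin{bmatrix}0_{2\times3}\\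 -e_3^\top[v]_\times\end{bmatrix}&\Delta\\ [m_{\mathcal I}]_\times&0_{3\times3}\end{bmatrix}.$$ For the $\bar\lambda$ parametrization, $$A^\star=\begin{bmatrix}-[\Omega]_\times&0_{3\times3}\\ g[R^\top e_3]_\times & -[\Omega]_\times\end{bmatrix},\qquad C^\star=\begin{bmatrix}\begin{bmatrix}0_{2\times3}\\ -e_3^\top[v]_\times R\end{bmatrix}&\Delta\\ [m_{\mathcal I}]_\times R&0_{3\times3}\end{bmatrix}.$$ In both cases $A^\star(t)\in\mathbb{R}^{6\times6}$, $C^\star(t)\in\mathbb{R}^{6\times6}$, and $$M=\begin{bmatrix}C^\star\\ C^\star A^\star+\dot C^\star\end{bmatrix}\in\mathbb{R}^{12\times 6},\qquad D=M^\top M\in\mathbb{R}^{6\times6}.$$ *)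

theory Defs
  imports "HOL-Analysis.Analysis"
begin

definition skew :: "real^3 \<Rightarrow> real^3^3"
  where "skew u = matrix (cross3 u)"

lemma skew_mult_vec: "skew u *v w = cross3 u w"
  using bilinear_cross unfolding skew_def bilinear_def by (simp add: matrix_works)

text \<open>Block matrices are indexed by sum types; in particular, \<open>6 \<times> 6\<close> matrices have
  type \<open>real^(3+3)^(3+3)\<close> and \<open>12 \<times> 6\<close> matrices have type
  \<open>real^(3+3)^((3+3)+(3+3))\<close>.\<close>

definition hstack :: "'a^'n^'r \<Rightarrow> 'a^'m^'r \<Rightarrow> 'a^('n + 'm)^'r"
  where "hstack A B = (\<chi> i j. case j of Inl k \<Rightarrow> A $ i $ k | Inr k \<Rightarrow> B $ i $ k)"

definition vstack :: "'a^'c^'n \<Rightarrow> 'a^'c^'m \<Rightarrow> 'a^'c^('n + 'm)"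
  where "vstack A B = (\<chi> i. case i of Inl k \<Rightarrow> A $ k | Inr k \<Rightarrow> B $ k)"

definition block_matrix ::
    "'a^'n^'r \<Rightarrow> 'a^'m^'r \<Rightarrow> 'a^'n^'s \<Rightarrow> 'a^'m^'s \<Rightarrow> 'a^('n + 'm)^('r + 's)"
  where "block_matrix A B C D = vstack (hstack A B) (hstack C D)"

definition pos_semidef :: "real^'n^'n \<Rightarrow> bool"
  where "pos_semidef A \<longleftrightarrow> transpose A = A \<and> (\<forall>x. 0 \<le> x \<bullet> (A *v x))"

definition loewner_ge :: "real^'n^'n \<Rightarrow> real^'n^'n \<Rightarrow> bool"
  where "loewner_ge A B \<longleftrightarrow> pos_semidef (A - B)"

text \<open>Below, \<open>axis 3 1 v* B\<close> is the row \<open>e\<^sub>3\<^sup>T B\<close>, and a \<open>3 \<times> 3\<close> matrix is written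
  as the vector of its rows.\<close>

definition Delta :: "real^3^3 \<Rightarrow> real^3^3"
  where "Delta R = vector [axis 1 1, axis 2 1, axis 3 1 v* R]"

definition A_tilde :: "real \<Rightarrow> real^3^3 \<Rightarrow> real^3 \<Rightarrow> real^(3+3)^(3+3)"
  where "A_tilde g R \<Omega> =
    block_matrix 0 0
                 (g *\<^sub>R (transpose R ** skew (axis 3 1))) (- skew \<Omega>)"

definition C_tilde :: "real^3 \<Rightarrow> real^3^3 \<Rightarrow> real^3 \<Rightarrow> real^(3+3)^(3+3)"
  where "C_tilde m R v =
    block_matrix (vector [0, 0, - (axis 3 1 v* skew v)]) (Delta R)
                 (skew m) 0"

definition A_bar :: "real \<Rightarrow> real^3^3 \<Rightarrow> real^3 \<Rightarrow> real^(3+3)^(3+3)"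
  where "A_bar g R \<Omega> =
    block_matrix (- skew \<Omega>) 0
                 (g *\<^sub>R skew (transpose R *v axis 3 1)) (- skew \<Omega>)"

definition C_bar :: "real^3 \<Rightarrow> real^3^3 \<Rightarrow> real^3 \<Rightarrow> real^(3+3)^(3+3)"
  where "C_bar m R v =
    block_matrix (vector [0, 0, - (axis 3 1 v* (skew v ** R))]) (Delta R)
                 (skew m ** R) 0"

text \<open>Time runs over \<open>t \<ge> 0\<close>, so the derivative at \<open>t = 0\<close> is one-sided.\<close>

definition obs_matrix :: "(real \<Rightarrow> real^'n^'n) \<Rightarrow> (real \<Rightarrow> real^'n^'m) \<Rightarrow> real \<Rightarrow> real^'n^('m + 'm)"
  where "obs_matrix A C t =
    vstack (C t) (C t ** A t + vector_derivative C (at t within {0..}))"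

definition obs_gram :: "(real \<Rightarrow> real^'n^'n) \<Rightarrow> (real \<Rightarrow> real^'n^'m) \<Rightarrow> real \<Rightarrow> real^'n^'n"
  where "obs_gram A C t = transpose (obs_matrix A C t) ** obs_matrix A C t"

definition D_tilde ::
    "real \<Rightarrow> real^3 \<Rightarrow> (real \<Rightarrow> real^3^3) \<Rightarrow> (real \<Rightarrow> real^3) \<Rightarrow> (real \<Rightarrow> real^3) \<Rightarrow> real \<Rightarrow> real^(3+3)^(3+3)"
  where "D_tilde g m R \<Omega> v =
    obs_gram (\<lambda>t. A_tilde g (R t) (\<Omega> t)) (\<lambda>t. C_tilde m (R t) (v t))"

definition D_bar ::
    "real \<Rightarrow> real^3 \<Rightarrow> (real \<Rightarrow> real^3^3) \<Rightarrow> (real \<Rightarrow> real^3) \<Rightarrow> (real \<Rightarrow> real^3) \<Rightarrow> real \<Rightarrow> real^(3+3)^(3+3)"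
  where "D_bar g m R \<Omega> v =
    obs_gram (\<lambda>t. A_bar g (R t) (\<Omega> t)) (\<lambda>t. C_bar m (R t) (v t))"

end

theory Submission
  imports Defs
begin

text \<open>
  Let \<open>z = (x, y)\<close>, \<open>\<epsilon> = |M z|\<close>, and \<open>X = x\<close> or \<open>X = R x\<close> depending on the parametrization. The rows of
  \<open>M\<close> bound \<open>y\<^sub>1\<close>, \<open>y\<^sub>2\<close>, \<open>(R y)\<^sub>3 - (v \<times> X)\<^sub>3\<close>, \<open>m \<times> X\<close> and the first two components of
  \<open>w = g R\<^sup>T (e\<^sub>3 \<times> X) - \<Omega> \<times> y\<close> by \<open>\<epsilon>\<close>. Put \<open>h = |e\<^sub>3 \<times> X|\<close>. As \<open>e\<^sub>3 \<times> X\<close> is horizontal, the first two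
  components of \<open>R\<^sup>T (e\<^sub>3 \<times> X)\<close> have norm at least \<open>|R\<^sub>3\<^sub>3| h\<close>, while \<open>\<rho> |y\<^sub>3| \<le> 3 \<epsilon> + |(v \<times> X)\<^sub>3|\<close> with
  \<open>|(v \<times> X)\<^sub>3| \<le> v\<^sub>m\<^sub>a\<^sub>x h\<close>. Hence \<open>g \<rho>\<^sup>2 h \<le> O(\<epsilon>) + (|\<Omega>\<^sub>1| + |\<Omega>\<^sub>2|) |(v \<times> X)\<^sub>3|\<close>, and in each of the three
  cases the last product is at most \<open>3/4 g \<rho>\<^sup>2 h\<close>. So \<open>h\<close> and \<open>y\<^sub>3\<close> are \<open>O(\<epsilon>)\<close>, and \<open>X\<close> is controlled by
  \<open>m \<times> X\<close> and \<open>e\<^sub>3 \<times> X\<close> because \<open>m\<close> and \<open>e\<^sub>3\<close> are not collinear.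
\<close>

section \<open>Block vectors and block matrices\<close>

definition upper :: "'a^(('n::finite) + ('m::finite)) \<Rightarrow> 'a^'n"
  where "upper z = (\<chi> i. z $ Inl i)"

definition lower :: "'a^(('n::finite) + ('m::finite)) \<Rightarrow> 'a^'m"
  where "lower z = (\<chi> i. z $ Inr i)"

lemma sum_UNIV_Plus:
  fixes f :: "('n::finite) + ('m::finite) \<Rightarrow> 'b::comm_monoid_add"
  shows "sum f UNIV = (\<Sum>i\<in>UNIV. f (Inl i)) + (\<Sum>i\<in>UNIV. f (Inr i))"
  unfolding UNIV_Plus_UNIV[symmetric] by (subst sum.Plus) simp_all

lemma norm_upper_lower:
  fixes z :: "real^(('n::finite) + ('m::finite))"
  shows "(norm z)\<^sup>2 = (norm (upper z))\<^sup>2 + (norm (lower z))\<^sup>2"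
  by (simp add: power2_norm_eq_inner inner_vec_def sum_UNIV_Plus upper_def lower_def)

lemma norm_le_upper_lower:
  fixes z :: "real^(('n::finite) + ('m::finite))"
  shows "norm z \<le> norm (upper z) + norm (lower z)"
  by (rule power2_le_imp_le) (simp_all add: norm_upper_lower power2_sum)

lemma norm_upper_le: "norm (upper z) \<le> norm (z :: real^(('n::finite) + ('m::finite)))"
  by (rule power2_le_imp_le) (simp_all add: norm_upper_lower)

lemma norm_lower_le: "norm (lower z) \<le> norm (z :: real^(('n::finite) + ('m::finite)))"
  by (rule power2_le_imp_le) (simp_all add: norm_upper_lower)

lemma vstack_mult_vec:
  "upper (vstack A B *v z) = A *v z" "lower (vstack A B *v z) = B *v z"
  by (simp_all add: vec_eq_iff upper_def lower_def vstack_def matrix_vector_mult_def)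

lemma hstack_mult_vec: "hstack A B *v z = A *v upper z + B *v lower z"
  by (simp add: vec_eq_iff upper_def lower_def hstack_def matrix_vector_mult_def sum_UNIV_Plus)

lemma block_matrix_mult_vec:
  "upper (block_matrix A B C D *v z) = A *v upper z + B *v lower z"
  "lower (block_matrix A B C D *v z) = C *v upper z + D *v lower z"
  by (simp_all add: block_matrix_def vstack_mult_vec hstack_mult_vec)

text \<open>The quadratic form of \<open>transpose M ** M\<close> at \<open>z\<close> is the square
  of \<open>norm (M *v z)\<close>. This reduces the theorem to finding one \<open>K\<close>,
  independent of time, with \<open>norm z \<le> K * norm (M *v z)\<close>.\<close>

lemma loewner_ge_gram:
  fixes M :: "real^'n^'m"
  assumes "K > 0" and "\<And>z. norm z \<le> K * norm (M *v z)"
  shows "loewner_ge (transpose M ** M) ((1 / K\<^sup>2) *\<^sub>R mat 1)"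
proof -
  have "0 \<le> z \<bullet> ((transpose M ** M - (1 / K\<^sup>2) *\<^sub>R mat 1) *v z)" for z
  proof -
    have "(norm z)\<^sup>2 \<le> (K * norm (M *v z))\<^sup>2"
      using assms(2) by (simp add: power_mono)
    then have "(norm z)\<^sup>2 / K\<^sup>2 \<le> (norm (M *v z))\<^sup>2"
      using assms(1) by (simp add: field_simps)
    moreover have "z \<bullet> ((transpose M ** M) *v z) = (norm (M *v z))\<^sup>2"
      by (metis dot_lmul_matrix matrix_vector_mul_assoc power2_norm_eq_inner
          transpose_matrix_vector inner_commute)
    ultimately show ?thesis
      by (simp add: matrix_vector_mult_diff_rdistrib scaleR_matrix_vector_assoc[symmetric]
          inner_diff_right power2_norm_eq_inner)
  qed
  moreover have "transpose (transpose M ** M - (1 / K\<^sup>2) *\<^sub>R mat 1)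
      = transpose M ** M - (1 / K\<^sup>2) *\<^sub>R (mat 1 :: real^'n^'n)"
  proof -
    have "transpose (transpose M ** M) = transpose M ** M"
      by (simp add: matrix_transpose_mul)
    then show ?thesis
      by (simp add: vec_eq_iff transpose_def mat_def)
  qed
  ultimately show ?thesis
    unfolding loewner_ge_def pos_semidef_def by blast
qed

section \<open>Cross products and rotations in three dimensions\<close>

lemma norm_le_cross3_cross3:
  fixes a b x :: "real^3"
  assumes "norm a = 1" "norm b = 1"
  shows "norm x * norm (cross3 a b) \<le> 2 * (norm (cross3 a x) + norm (cross3 b x))"
proof -
  let ?n = "cross3 a b"
  have cb: "norm (cross3 u w) \<le> norm u * norm w" for u w :: "real^3"
    by (rule power2_le_imp_le) (simp_all add: norm_cross power_mult_distrib)
  have "x \<bullet> ?n = - (b \<bullet> cross3 a x)"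
    by (simp add: cross3_def inner_vec_def sum_3 algebra_simps)
  then have 1: "\<bar>x \<bullet> ?n\<bar> \<le> norm (cross3 a x)"
    using Cauchy_Schwarz_ineq2[of b "cross3 a x"] assms by simp
  \<comment> \<open>This is the Jacobi identity.\<close>
  have "cross3 x ?n = cross3 b (cross3 a x) - cross3 a (cross3 b x)"
    by (simp add: cross3_def vec_eq_iff forall_3 algebra_simps)
  then have "norm (cross3 x ?n) \<le> norm (cross3 b (cross3 a x)) + norm (cross3 a (cross3 b x))"
    by (simp add: norm_triangle_ineq4)
  also have "\<dots> \<le> norm (cross3 a x) + norm (cross3 b x)"
    using cb[of b "cross3 a x"] cb[of a "cross3 b x"] assms by simp
  finally have 2: "norm (cross3 x ?n) \<le> norm (cross3 a x) + norm (cross3 b x)" .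
  \<comment> \<open>Lagrange's identity splits the product into the parts of \<open>x\<close>
    orthogonal to and along \<open>?n\<close>. The term \<open>norm (cross3 a x)\<close> bounds
    contributions to both parts, hence the factor 2 in the claim.\<close>
  have "norm x * norm ?n \<le> norm (cross3 x ?n) + \<bar>x \<bullet> ?n\<bar>"
  proof (rule power2_le_imp_le)
    have "(norm x * norm ?n)\<^sup>2 = (norm (cross3 x ?n))\<^sup>2 + (x \<bullet> ?n)\<^sup>2"
      by (simp add: norm_cross power_mult_distrib)
    then show "(norm x * norm ?n)\<^sup>2 \<le> (norm (cross3 x ?n) + \<bar>x \<bullet> ?n\<bar>)\<^sup>2"
      by (simp add: power2_sum)
  qed simp
  with 1 2 show ?thesis
    using norm_ge_zero[of "cross3 b x"] by argo
qed

lemma norm_rotation_mult_vec: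
  "rotation_matrix A \<Longrightarrow> norm (A *v x) = norm (x :: real^'n)"
  using orthogonal_transformation_matrix[of "(*v) A"]
  by (simp add: rotation_matrix_def orthogonal_transformation_norm)

lemma sum_squares_3: "(norm (x::real^3))\<^sup>2 = (x$1)\<^sup>2 + (x$2)\<^sup>2 + (x$3)\<^sup>2"
  unfolding power2_norm_eq_inner by (simp add: inner_vec_def sum_3 power2_eq_square)

lemma rotation_matrix_transpose_mult:
  assumes "rotation_matrix R"
  shows "R ** transpose R = mat 1" "transpose R ** R = mat 1"
  using assms by (simp_all add: rotation_matrix_def orthogonal_matrix_def)

lemma rotation_matrix_transpose:
  "rotation_matrix R \<Longrightarrow> rotation_matrix (transpose R)"
  by (simp add: rotation_matrix_def orthogonal_matrix_transpose)

lemma rotation_third_row_column: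
  assumes "rotation_matrix (R :: real^3^3)"
  shows "(R$3$1)\<^sup>2 + (R$3$2)\<^sup>2 + (R$3$3)\<^sup>2 = 1"
    and "(R$1$3)\<^sup>2 + (R$2$3)\<^sup>2 + (R$3$3)\<^sup>2 = 1"
proof -
  have "(R ** transpose R)$3$3 = 1" "(transpose R ** R)$3$3 = 1"
    using rotation_matrix_transpose_mult[OF assms] by (simp_all add: mat_def)
  then show "(R$3$1)\<^sup>2 + (R$3$2)\<^sup>2 + (R$3$3)\<^sup>2 = 1" "(R$1$3)\<^sup>2 + (R$2$3)\<^sup>2 + (R$3$3)\<^sup>2 = 1"
    by (simp_all add: matrix_matrix_mult_def transpose_def sum_3 power2_eq_square)
qed

text \<open>The transpose of \<open>R\<close> preserves the norm, so it suffices to bound the third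
  component of the image from above. That component pairs \<open>u\<close> with the horizontal part
  of the third column of \<open>R\<close>, whose squared norm is
  \<open>1 - (R$3$3)\<^sup>2\<close>.\<close>

lemma rotation_horizontal_lower_bound:
  fixes R :: "real^3^3"
  assumes R: "rotation_matrix R" and "u$3 = 0"
  shows "\<bar>R$3$3\<bar> * norm u \<le> \<bar>(transpose R *v u)$1\<bar> + \<bar>(transpose R *v u)$2\<bar>"
proof -
  define a where "a = transpose R *v u"
  have "norm a = norm u"
    unfolding a_def using R rotation_matrix_transpose norm_rotation_mult_vec by blast
  then have n: "(a$1)\<^sup>2 + (a$2)\<^sup>2 + (a$3)\<^sup>2 = (u$1)\<^sup>2 + (u$2)\<^sup>2"
    using sum_squares_3[of a] sum_squares_3[of u] \<open>u$3 = 0\<close> by simp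
  have a3: "a$3 = R$1$3 * u$1 + R$2$3 * u$2"
    by (simp add: a_def transpose_def matrix_vector_mult_def sum_3 \<open>u$3 = 0\<close>)
  \<comment> \<open>Cauchy-Schwarz in the plane: the added square is exactly its defect.\<close>
  have "(a$3)\<^sup>2 \<le> (a$3)\<^sup>2 + (R$1$3 * u$2 - R$2$3 * u$1)\<^sup>2"
    by simp
  also have "\<dots> = ((R$1$3)\<^sup>2 + (R$2$3)\<^sup>2) * ((u$1)\<^sup>2 + (u$2)\<^sup>2)"
    unfolding a3 by algebra
  also have "(R$1$3)\<^sup>2 + (R$2$3)\<^sup>2 = 1 - (R$3$3)\<^sup>2"
    using rotation_third_row_column(2)[OF R] by simp
  finally have "(R$3$3)\<^sup>2 * ((u$1)\<^sup>2 + (u$2)\<^sup>2) \<le> (a$1)\<^sup>2 + (a$2)\<^sup>2"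
    using n by (simp add: algebra_simps)
  then have "(\<bar>R$3$3\<bar> * norm u)\<^sup>2 \<le> (a$1)\<^sup>2 + (a$2)\<^sup>2"
    using sum_squares_3[of u] \<open>u$3 = 0\<close> by (simp add: power_mult_distrib)
  also have "\<dots> \<le> (\<bar>a$1\<bar> + \<bar>a$2\<bar>)\<^sup>2"
    by (simp add: power2_sum)
  finally have "(\<bar>R$3$3\<bar> * norm u)\<^sup>2 \<le> (\<bar>a$1\<bar> + \<bar>a$2\<bar>)\<^sup>2" .
  then show ?thesis
    unfolding a_def[symmetric] by (rule power2_le_imp_le) simp
qed

section \<open>The estimate at a fixed instant, with constants independent of time\<close>

locale static_bounds =
  fixes g \<rho> V W :: real and m :: "real^3"
  assumes g: "g > 0" and rho: "\<rho> > 0" and V: "V > 0" and W: "W > 0"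
    and m: "norm m = 1" "cross3 m (axis 3 1) \<noteq> 0"
begin

text \<open>The factor 4 is 1 / (1 - 3/4): it comes from absorbing
  \<open>3/4 * (g * \<rho>\<^sup>2 * h)\<close> into the left-hand side.\<close>

definition K\<^sub>h where "K\<^sub>h = 4 * (\<rho> * (2 + 2 * W) + 6 * W) / (g * \<rho>\<^sup>2)"

definition K\<^sub>x where "K\<^sub>x = 2 * (1 + K\<^sub>h) / norm (cross3 m (axis 3 1))"

text \<open>The summand 2 accounts for the first two components of \<open>y\<close>, the quotient
  for the third.\<close>

definition K\<^sub>y where "K\<^sub>y = 2 + (3 + V * K\<^sub>h) / \<rho>"

lemma constants_pos: "K\<^sub>h > 0" "K\<^sub>x > 0" "K\<^sub>y > 0"
proof -
  show h: "K\<^sub>h > 0"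
    unfolding K\<^sub>h_def using g rho W by (simp add: add_pos_pos)
  show "K\<^sub>x > 0"
    unfolding K\<^sub>x_def using h m by simp
  show "K\<^sub>y > 0"
    unfolding K\<^sub>y_def using h rho V by (simp add: add_pos_pos)
qed

text \<open>Here \<open>x\<close> stands for X, so that one estimate serves both
  parametrizations.\<close>

lemma static_estimate:
  fixes R :: "real^3^3" and \<Omega> v x y :: "real^3"
  defines "w \<equiv> g *\<^sub>R (transpose R *v cross3 (axis 3 1) x) - cross3 \<Omega> y"
  assumes R: "rotation_matrix R" and R33: "\<bar>R$3$3\<bar> \<ge> \<rho>"
    and v: "norm v \<le> V" and \<Omega>: "norm \<Omega> \<le> W"
    and cases: "cross3 v (axis 3 1) = 0 \<or> \<Omega> = 0 \<or> V * W \<le> g * \<rho>\<^sup>2 / sqrt 6"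
    and y12: "\<bar>y$1\<bar> \<le> \<epsilon>" "\<bar>y$2\<bar> \<le> \<epsilon>"
    and vel: "\<bar>(R *v y)$3 - cross3 v x $ 3\<bar> \<le> \<epsilon>"
    and mag: "norm (cross3 m x) \<le> \<epsilon>"
    and w12: "\<bar>w$1\<bar> \<le> \<epsilon>" "\<bar>w$2\<bar> \<le> \<epsilon>"
  shows "norm x \<le> K\<^sub>x * \<epsilon>" and "norm y \<le> K\<^sub>y * \<epsilon>"
proof -
  have eps: "\<epsilon> \<ge> 0"
    using mag norm_ge_zero order_trans by blast
  define u where "u = cross3 (axis 3 1) x"
  define h where "h = norm u"
  have h0: "h \<ge> 0" by (simp add: h_def)
  define q where "q = \<bar>cross3 v x $ 3\<bar>"
  define S where "S = \<bar>\<Omega>$1\<bar> + \<bar>\<Omega>$2\<bar>"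
  have Om: "\<bar>\<Omega>$i\<bar> \<le> W" for i
    using component_le_norm_cart[of \<Omega> i] \<Omega> by linarith
  have row: "\<bar>R$3$1\<bar> \<le> 1" "\<bar>R$3$2\<bar> \<le> 1"
    unfolding abs_square_le_1[symmetric] using rotation_third_row_column(1)[OF R]
      zero_le_power2[of "R$3$1"] zero_le_power2[of "R$3$2"] zero_le_power2[of "R$3$3"] by linarith+
  \<comment> \<open>Two forms of one triple product: the first gives the bound by
    \<open>V * h\<close>, the second vanishes for vertical motion.\<close>
  have q_alt: "cross3 v x $ 3 = - (v \<bullet> u)" "cross3 v x $ 3 = - (x \<bullet> cross3 v (axis 3 1))"
    by (simp_all add: u_def cross3_def inner_vec_def sum_3 axis_def algebra_simps)
  have q: "q \<le> V * h"
  proof -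
    have "\<bar>v \<bullet> u\<bar> \<le> norm v * h"
      unfolding h_def by (rule Cauchy_Schwarz_ineq2)
    also have "\<dots> \<le> V * h"
      using v h0 by (rule mult_right_mono)
    finally show ?thesis
      by (simp add: q_def q_alt(1))
  qed
  \<comment> \<open>One \<open>\<epsilon>\<close> comes from \<open>vel\<close>, the other two from
    the first two components of \<open>y\<close>, whose coefficients in the third row of
    \<open>R\<close> are at most 1 in absolute value.\<close>
  have y3: "\<rho> * \<bar>y$3\<bar> \<le> 3 * \<epsilon> + q"
  proof -
    have "(R *v y)$3 = R$3$1 * y$1 + R$3$2 * y$2 + R$3$3 * y$3"
      by (simp add: matrix_vector_mult_def sum_3)
    moreover have "\<bar>R$3$1 * y$1\<bar> \<le> \<epsilon>" "\<bar>R$3$2 * y$2\<bar> \<le> \<epsilon>"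
      using mult_mono[OF row(1) y12(1)] mult_mono[OF row(2) y12(2)] by (simp_all add: abs_mult)
    ultimately have "\<bar>R$3$3 * y$3\<bar> \<le> 3 * \<epsilon> + q"
      using vel unfolding q_def by linarith
    moreover have "\<rho> * \<bar>y$3\<bar> \<le> \<bar>R$3$3\<bar> * \<bar>y$3\<bar>"
      using R33 by (rule mult_right_mono) simp
    ultimately show ?thesis
      by (simp add: abs_mult)
  qed
  \<comment> \<open>The left-hand side is 0 for vertical motion (\<open>q = 0\<close>) and for pure
    translation (\<open>S = 0\<close>). For slow motion, sqrt 6 is weakened to 2 and
    \<open>S\<close> is at most sqrt 2 times \<open>W\<close>, rounded up to \<open>3/2 * W\<close>;
    this gives 3/2 * 1/2 = 3/4. A factor below 1 is what the later absorption requires.\<close>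
  have Sq: "S * q \<le> 3/4 * (g * \<rho>\<^sup>2 * h)"
    using cases
  proof (elim disjE)
    assume "V * W \<le> g * \<rho>\<^sup>2 / sqrt 6"
    also have "\<dots> \<le> g * \<rho>\<^sup>2 / 2"
      using g by (intro divide_left_mono) (auto simp: real_le_rsqrt)
    finally have VW: "V * W \<le> g * \<rho>\<^sup>2 / 2" .
    have "S \<le> 3/2 * W"
    proof (rule power2_le_imp_le)
      have "S\<^sup>2 \<le> 2 * ((\<Omega>$1)\<^sup>2 + (\<Omega>$2)\<^sup>2)"
        using sum_squares_bound[of "\<bar>\<Omega>$1\<bar>" "\<bar>\<Omega>$2\<bar>"] by (simp add: S_def power2_sum)
      also have "\<dots> \<le> 2 * (norm \<Omega>)\<^sup>2"
        by (simp add: sum_squares_3)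
      also have "\<dots> \<le> 2 * W\<^sup>2"
        using \<Omega> by (simp add: power_mono)
      also have "\<dots> \<le> (3/2 * W)\<^sup>2"
        by (simp add: power2_eq_square)
      finally show "S\<^sup>2 \<le> (3/2 * W)\<^sup>2" .
    qed (use W in simp)
    then have "S * q \<le> (3/2 * W) * (V * h)"
      using q W by (intro mult_mono) (auto simp: q_def)
    also have "\<dots> = 3/2 * h * (V * W)"
      by simp
    also have "\<dots> \<le> 3/2 * h * (g * \<rho>\<^sup>2 / 2)"
      using VW h0 by (intro mult_left_mono) auto
    finally show ?thesis
      by (simp add: algebra_simps)
  qed (use g h0 in \<open>simp_all add: S_def q_def q_alt(2)\<close>)
  have h_bound: "h \<le> K\<^sub>h * \<epsilon>"
  proof -
    define a where "a = transpose R *v u"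
    \<comment> \<open>In these two components \<open>\<Omega>$3\<close> multiplies only
      \<open>y$1\<close> and \<open>y$2\<close>, which are already small. Only
      \<open>\<Omega>$1\<close> and \<open>\<Omega>$2\<close> meet \<open>y$3\<close>, which is why
      \<open>S\<close> omits \<open>\<Omega>$3\<close>.\<close>
    have cross: "cross3 \<Omega> y $ 1 = \<Omega>$2 * y$3 - \<Omega>$3 * y$2" "cross3 \<Omega> y $ 2 = \<Omega>$3 * y$1 - \<Omega>$1 * y$3"
      by (simp_all add: cross3_def)
    have "u $ 3 = 0"
      by (simp add: u_def cross3_def axis_def)
    then have "\<rho> * h \<le> \<bar>a$1\<bar> + \<bar>a$2\<bar>"
      using rotation_horizontal_lower_bound[OF R, of u] mult_right_mono[OF R33 h0]
      by (simp add: a_def h_def)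
    then have 1: "g * (\<rho> * h) \<le> \<bar>g * a$1\<bar> + \<bar>g * a$2\<bar>"
      using mult_left_mono[of "\<rho> * h" "\<bar>a$1\<bar> + \<bar>a$2\<bar>" g] g by (simp add: abs_mult algebra_simps)
    have Oy: "\<bar>\<Omega>$3 * y$2\<bar> \<le> W * \<epsilon>" "\<bar>\<Omega>$3 * y$1\<bar> \<le> W * \<epsilon>"
      using mult_mono[OF Om[of 3] y12(2)] mult_mono[OF Om[of 3] y12(1)] W by (simp_all add: abs_mult)
    have w: "w$1 = g * a$1 - (\<Omega>$2 * y$3 - \<Omega>$3 * y$2)" "w$2 = g * a$2 - (\<Omega>$3 * y$1 - \<Omega>$1 * y$3)"
      by (simp_all add: w_def a_def u_def cross)
    have "\<bar>g * a$1\<bar> + \<bar>g * a$2\<bar> \<le> 2 * \<epsilon> + 2 * (W * \<epsilon>) + (\<bar>\<Omega>$2 * y$3\<bar> + \<bar>\<Omega>$1 * y$3\<bar>)"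
      using w12 Oy w by linarith
    also have "\<bar>\<Omega>$2 * y$3\<bar> + \<bar>\<Omega>$1 * y$3\<bar> = S * \<bar>y$3\<bar>"
      by (simp add: S_def abs_mult algebra_simps)
    finally have "g * (\<rho> * h) \<le> 2 * \<epsilon> + 2 * (W * \<epsilon>) + S * \<bar>y$3\<bar>"
      using 1 by linarith
    \<comment> \<open>The extra factor \<open>\<rho>\<close> turns \<open>\<bar>y$3\<bar>\<close>
      into the quantity bounded by \<open>y3\<close>.\<close>
    then have "\<rho> * (g * (\<rho> * h)) \<le> \<rho> * (2 * \<epsilon> + 2 * (W * \<epsilon>) + S * \<bar>y$3\<bar>)"
      using rho by (intro mult_left_mono) auto
    also have "\<dots> = \<rho> * (2 + 2 * W) * \<epsilon> + S * (\<rho> * \<bar>y$3\<bar>)"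
      by (simp add: algebra_simps)
    also have "S * (\<rho> * \<bar>y$3\<bar>) \<le> S * (3 * \<epsilon> + q)"
      using y3 by (rule mult_left_mono) (simp add: S_def)
    also have "\<dots> = S * (3 * \<epsilon>) + S * q"
      by (simp add: algebra_simps)
    also have "S * (3 * \<epsilon>) \<le> 2 * W * (3 * \<epsilon>)"
      using Om[of 1] Om[of 2] eps by (intro mult_right_mono) (auto simp: S_def)
    finally have "g * \<rho>\<^sup>2 * h \<le> \<rho> * (2 + 2 * W) * \<epsilon> + (2 * W * (3 * \<epsilon>) + 3/4 * (g * \<rho>\<^sup>2 * h))"
      using Sq by (simp add: power2_eq_square algebra_simps)
    then have "g * \<rho>\<^sup>2 * h \<le> 4 * (\<rho> * (2 + 2 * W) + 6 * W) * \<epsilon>"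
      by (simp add: algebra_simps)
    then show ?thesis
      using g rho by (simp add: K\<^sub>h_def pos_le_divide_eq mult.commute)
  qed
  show "norm x \<le> K\<^sub>x * \<epsilon>"
  proof -
    have "norm x * norm (cross3 m (axis 3 1)) \<le> 2 * (\<epsilon> + K\<^sub>h * \<epsilon>)"
      using norm_le_cross3_cross3[of m "axis 3 1" x] m mag h_bound by (simp add: h_def u_def)
    then show ?thesis
      using m by (simp add: K\<^sub>x_def pos_le_divide_eq algebra_simps)
  qed
  show "norm y \<le> K\<^sub>y * \<epsilon>"
  proof -
    have "\<rho> * \<bar>y$3\<bar> \<le> 3 * \<epsilon> + V * (K\<^sub>h * \<epsilon>)"
      using y3 q mult_left_mono[OF h_bound, of V] V by linarith
    then have "\<bar>y$3\<bar> \<le> (3 + V * K\<^sub>h) / \<rho> * \<epsilon>"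
      using rho by (simp add: pos_le_divide_eq algebra_simps)
    moreover have "norm y \<le> \<bar>y$1\<bar> + \<bar>y$2\<bar> + \<bar>y$3\<bar>"
      using norm_le_l1_cart[of y] by (simp add: sum_3)
    ultimately show ?thesis
      using y12 by (simp add: K\<^sub>y_def algebra_simps)
  qed
qed

end

section \<open>Differentiability of the output matrices and their constant rows\<close>

lemma differentiable_vec_components:
  fixes f :: "'a::real_normed_vector \<Rightarrow> 'b::euclidean_space^'m"
  assumes "\<And>i. (\<lambda>t. f t $ i) differentiable F"
  shows "f differentiable F"
proof -
  \<comment> \<open>The function is the finite sum of its components embedded by these bounded
    linear maps.\<close>
  have "bounded_linear (axis i :: 'b \<Rightarrow> 'b^'m)" for i
    by (auto simp: linear_conv_bounded_linear[symmetric] vec_eq_iff axis_def intro!: linearI)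
  then have "(\<lambda>t. axis i (f t $ i) :: 'b^'m) differentiable F" for i
    using assms[of i] bounded_linear.has_derivative unfolding differentiable_def by blast
  then have "(\<lambda>t. \<Sum>i\<in>UNIV. axis i (f t $ i)) differentiable F"
    by (intro differentiable_sum) auto
  also have "(\<lambda>t. \<Sum>i\<in>UNIV. axis i (f t $ i)) = f"
    by (simp add: fun_eq_iff vec_eq_iff axis_def)
  finally show ?thesis .
qed

lemma differentiable_entry:
  fixes C :: "'a::real_normed_vector \<Rightarrow> 'b::real_normed_vector^'m"
  assumes "C differentiable F"
  shows "(\<lambda>t. C t $ i) differentiable F"
  using assms bounded_linear.has_derivative[OF bounded_linear_vec_nth]
  unfolding differentiable_def by blast

text \<open>\<open>vector_derivative\<close> is a choice of derivative, so its row is known only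
  through uniqueness. Uniqueness holds because \<open>t\<close> is a limit point of the half-line
  from the right, also at \<open>t = 0\<close>.\<close>

lemma vector_derivative_constant_row:
  fixes C :: "real \<Rightarrow> real^'n^'m"
  assumes "C differentiable (at t within {0..})" and "t \<ge> 0" and "\<And>s. C s $ i = c"
  shows "vector_derivative C (at t within {0..}) $ i = 0"
proof -
  have "at t within {0..} \<noteq> bot"
  proof
    assume "at t within {0..} = bot"
    moreover have "at_right t \<le> at t within {0..}"
      using \<open>t \<ge> 0\<close> by (intro at_le) auto
    ultimately show False
      using trivial_limit_at_right_real[of t] by (simp add: bot_unique)
  qed
  moreover have "((\<lambda>s. C s $ i) has_vector_derivative
      vector_derivative C (at t within {0..}) $ i) (at t within {0..})"
    by (rule bounded_linear.has_vector_derivative[OF bounded_linear_vec_nth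
          assms(1)[unfolded vector_derivative_works]])
  moreover have "((\<lambda>s. C s $ i) has_vector_derivative 0) (at t within {0..})"
    unfolding assms(3) by simp
  ultimately show ?thesis
    by (rule vector_derivative_unique_within)
qed

lemma axis_vector_matrix_mult: "axis i 1 v* B = (B :: real^'n^'m) $ i"
  by (simp add: vec_eq_iff vector_matrix_mult_def axis_def if_distrib[of "\<lambda>x. x * _"]
      if_distrib[of "\<lambda>x. _ * x"] cong: if_cong)

lemma skew_third_row: "skew v $ 3 $ 1 = - v $ 2" "skew v $ 3 $ 2 = v $ 1" "skew v $ 3 $ 3 = 0"
  by (simp_all add: skew_def matrix_def cross3_def axis_def)

text \<open>This makes the \<open>vector_derivative\<close> in \<open>obs_matrix\<close> a genuine
  derivative. Only the third row depends on time.\<close>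

lemma C_tilde_differentiable:
  assumes "R differentiable F" "v differentiable F"
  shows "(\<lambda>t. C_tilde m (R t) (v t)) differentiable F"
proof (intro differentiable_vec_components)
  fix i j :: "3 + 3"
  have [simp]: "(\<lambda>t. R t $ k $ l) differentiable F" "(\<lambda>t. v t $ k) differentiable F" for k l
    using assms by (auto intro: differentiable_entry)
  have [simp]: "(\<lambda>t. skew (v t) $ 3 $ k) differentiable F" for k
    using exhaust_3[of k] by (auto simp: skew_third_row)
  have "i = Inl 1 \<or> i = Inl 2 \<or> i = Inl 3 \<or> (\<exists>k. i = Inr k)"
    by (cases i) (use exhaust_3 in auto)
  then show "(\<lambda>t. C_tilde m (R t) (v t) $ i $ j) differentiable F"
    by (cases j)
      (auto simp: C_tilde_def block_matrix_def vstack_def hstack_def Delta_def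
        axis_vector_matrix_mult)
qed

lemma C_bar_differentiable:
  assumes "R differentiable (at a within T)" "v differentiable (at a within T)"
  shows "(\<lambda>t. C_bar m (R t) (v t)) differentiable (at a within T)"
proof (intro differentiable_vec_components)
  fix i j :: "3 + 3"
  have [simp]: "(\<lambda>t. R t $ k $ l) differentiable (at a within T)" "(\<lambda>t. v t $ k) differentiable (at a within T)" for k l
    using assms by (auto intro: differentiable_entry)
  have [simp]: "(\<lambda>t. (S ** R t) $ k $ l) differentiable (at a within T)" for S :: "real^3^3" and k l
    by (auto simp: matrix_matrix_mult_def sum_3 intro!: differentiable_add differentiable_mult)
  have [simp]: "(\<lambda>t. (skew (v t) ** R t) $ 3 $ k) differentiable (at a within T)" for k
    using exhaust_3[of k] by (auto simp: matrix_matrix_mult_def sum_3 skew_third_row)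
  have "i = Inl 1 \<or> i = Inl 2 \<or> i = Inl 3 \<or> (\<exists>k. i = Inr k)"
    by (cases i) (use exhaust_3 in auto)
  then show "(\<lambda>t. C_bar m (R t) (v t) $ i $ j) differentiable (at a within T)"
    by (cases j)
      (auto simp: C_bar_def block_matrix_def vstack_def hstack_def Delta_def
        axis_vector_matrix_mult)
qed

section \<open>Action of the system matrices on block vectors\<close>

lemma Delta_mult_vec:
  "(Delta R *v y) $ 1 = y $ 1" "(Delta R *v y) $ 2 = y $ 2" "(Delta R *v y) $ 3 = (R *v y) $ 3"
  by (simp_all add: Delta_def matrix_vector_mul_component dot_lmul_matrix inner_axis')

lemma third_row_mult_vec:
  "(vector [0, 0, - (axis 3 1 v* B)] *v x) $ (1::3) = 0"
  "(vector [0, 0, - (axis 3 1 v* B)] *v x) $ (2::3) = 0"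
  "(vector [0, 0, - (axis 3 1 v* B)] *v x) $ (3::3) = - (B *v x) $ 3" for B :: "real^'n^3"
  by (simp_all add: matrix_vector_mul_component axis_vector_matrix_mult)

lemma C_tilde_mult_vec:
  "upper (C_tilde m R v *v z) $ 1 = lower z $ 1"
  "upper (C_tilde m R v *v z) $ 2 = lower z $ 2"
  "upper (C_tilde m R v *v z) $ 3 = (R *v lower z) $ 3 - cross3 v (upper z) $ 3"
  "lower (C_tilde m R v *v z) = cross3 m (upper z)"
  by (simp_all add: C_tilde_def block_matrix_mult_vec Delta_mult_vec third_row_mult_vec
      skew_mult_vec)

lemma C_bar_mult_vec:
  "upper (C_bar m R v *v z) $ 1 = lower z $ 1"
  "upper (C_bar m R v *v z) $ 2 = lower z $ 2"
  "upper (C_bar m R v *v z) $ 3 = (R *v lower z) $ 3 - cross3 v (R *v upper z) $ 3"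
  "lower (C_bar m R v *v z) = cross3 m (R *v upper z)"
  by (simp_all add: C_bar_def block_matrix_mult_vec Delta_mult_vec third_row_mult_vec
      skew_mult_vec matrix_vector_mul_assoc[symmetric])

lemma skew_minus_mult_vec: "(- skew \<Omega>) *v y = - cross3 \<Omega> y"
proof -
  have "(- skew \<Omega>) *v y = - (skew \<Omega> *v y)"
    by (simp add: vec_eq_iff matrix_vector_mult_def sum_negf)
  then show ?thesis
    by (simp add: skew_mult_vec)
qed

lemma lower_A_tilde_mult_vec:
  "lower (A_tilde g R \<Omega> *v z) =
    g *\<^sub>R (transpose R *v cross3 (axis 3 1) (upper z)) - cross3 \<Omega> (lower z)"
  unfolding A_tilde_def block_matrix_mult_vec skew_minus_mult_vec
    scaleR_matrix_vector_assoc[symmetric] matrix_vector_mul_assoc[symmetric] skew_mult_vec by simp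

text \<open>Rotations commute with the cross product, and the transpose of \<open>R\<close> maps
  \<open>R *v x\<close> back to \<open>x\<close>. This brings the gravity block of
  \<open>A_bar\<close> into the form of that of \<open>A_tilde\<close>, with X =
  \<open>R *v x\<close>.\<close>

lemma cross3_transpose_rotation:
  assumes "rotation_matrix R"
  shows "cross3 (transpose R *v a) x = transpose R *v cross3 a (R *v x)"
  using cross_rotation_matrix[OF rotation_matrix_transpose[OF assms], of a "R *v x"]
  unfolding matrix_vector_mul_assoc[of "transpose R" R] rotation_matrix_transpose_mult[OF assms]
  by simp

lemma lower_A_bar_mult_vec:
  assumes "rotation_matrix R"
  shows "lower (A_bar g R \<Omega> *v z) =
    g *\<^sub>R (transpose R *v cross3 (axis 3 1) (R *v upper z)) - cross3 \<Omega> (lower z)"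
  unfolding A_bar_def block_matrix_mult_vec skew_minus_mult_vec skew_mult_vec
    scaleR_matrix_vector_assoc[symmetric] cross3_transpose_rotation[OF assms] by simp

text \<open>A constant row of \<open>C\<close> has zero derivative, so only the product of
  \<open>C\<close> and \<open>A\<close> contributes to it.\<close>

lemma obs_matrix_constant_row:
  assumes "C differentiable (at t within {0..})" and "t \<ge> 0" and "\<And>s. C s $ i = c"
  shows "lower (obs_matrix A C t *v z) $ i = (C t *v (A t *v z)) $ i"
proof -
  have "(vector_derivative C (at t within {0..}) *v z) $ i = 0"
    using vector_derivative_constant_row[OF assms] by (simp add: matrix_vector_mul_component)
  then show ?thesis
    unfolding obs_matrix_def vstack_mult_vec matrix_vector_mult_add_rdistrib
      matrix_vector_mul_assoc[symmetric] by simp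
qed

text \<open>Evaluation at zero arguments names the constant value that
  \<open>obs_matrix_constant_row\<close> asks for.\<close>

lemma C_tilde_constant_rows:
  "C_tilde m R v $ Inl 1 = C_tilde m 0 0 $ Inl 1" "C_tilde m R v $ Inl 2 = C_tilde m 0 0 $ Inl 2"
  by (simp_all add: C_tilde_def block_matrix_def vstack_def hstack_def Delta_def)

lemma C_bar_constant_rows:
  "C_bar m R v $ Inl 1 = C_bar m 0 0 $ Inl 1" "C_bar m R v $ Inl 2 = C_bar m 0 0 $ Inl 2"
  by (simp_all add: C_bar_def block_matrix_def vstack_def hstack_def Delta_def)

lemma abs_component_le: "norm z \<le> e \<Longrightarrow> \<bar>(z :: real^'n) $ i\<bar> \<le> e"
  using component_le_norm_cart order_trans by blast

section \<open>From the estimate to a uniform bound on both Gram matrices\<close>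

context static_bounds
begin

text \<open>
  The row of the observability matrix that contains the derivative of \<open>v\<close>, which may be unbounded,
  is discarded.
\<close>

lemma norm_le_output:
  fixes R :: "real^3^3" and \<Omega> v X :: "real^3" and z :: "real^(3+3)" and p :: "real^((3+3)+(3+3))"
  defines "w \<equiv> g *\<^sub>R (transpose R *v cross3 (axis 3 1) X) - cross3 \<Omega> (lower z)"
  assumes R: "rotation_matrix R" and R33: "\<bar>R$3$3\<bar> \<ge> \<rho>"
    and v: "norm v \<le> V" and \<Omega>: "norm \<Omega> \<le> W"
    and cases: "cross3 v (axis 3 1) = 0 \<or> \<Omega> = 0 \<or> V * W \<le> g * \<rho>\<^sup>2 / sqrt 6"
    and X: "norm (upper z) = norm X"
    and p: "upper (upper p) $ 1 = lower z $ 1" "upper (upper p) $ 2 = lower z $ 2"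
      "upper (upper p) $ 3 = (R *v lower z) $ 3 - cross3 v X $ 3"
      "lower (upper p) = cross3 m X"
      "upper (lower p) $ 1 = w $ 1" "upper (lower p) $ 2 = w $ 2"
  shows "norm z \<le> (K\<^sub>x + K\<^sub>y) * norm p"
proof -
  have n: "norm (upper (upper p)) \<le> norm p" "norm (lower (upper p)) \<le> norm p"
      "norm (upper (lower p)) \<le> norm p"
    by (rule order_trans[OF norm_upper_le norm_upper_le] order_trans[OF norm_lower_le norm_upper_le]
        order_trans[OF norm_upper_le norm_lower_le])+
  note c = abs_component_le[OF n(1), of 1] abs_component_le[OF n(1), of 2]
    abs_component_le[OF n(1), of 3] n(2)
    abs_component_le[OF n(3), of 1] abs_component_le[OF n(3), of 2]
  have "norm X \<le> K\<^sub>x * norm p" "norm (lower z) \<le> K\<^sub>y * norm p"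
    using static_estimate[OF R R33 v \<Omega> cases c[unfolded p w_def]] .
  then show ?thesis
    using norm_le_upper_lower[of z] X by (simp add: algebra_simps)
qed

lemma uniform_observability:
  fixes R :: "real \<Rightarrow> real^3^3" and \<Omega> v :: "real \<Rightarrow> real^3"
  assumes t: "t \<ge> 0"
    and diff: "R differentiable (at t within {0..})" "v differentiable (at t within {0..})"
    and R: "rotation_matrix (R t)" and R33: "\<bar>R t $ 3 $ 3\<bar> \<ge> \<rho>"
    and v: "norm (v t) \<le> V" and \<Omega>: "norm (\<Omega> t) \<le> W"
    and cases: "cross3 (v t) (axis 3 1) = 0 \<or> \<Omega> t = 0 \<or> V * W \<le> g * \<rho>\<^sup>2 / sqrt 6"
  shows "loewner_ge (D_tilde g m R \<Omega> v t) ((1 / (K\<^sub>x + K\<^sub>y)\<^sup>2) *\<^sub>R mat 1)"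
    and "loewner_ge (D_bar g m R \<Omega> v t) ((1 / (K\<^sub>x + K\<^sub>y)\<^sup>2) *\<^sub>R mat 1)"
proof -
  have K: "K\<^sub>x + K\<^sub>y > 0"
    using constants_pos by simp
  show "loewner_ge (D_tilde g m R \<Omega> v t) ((1 / (K\<^sub>x + K\<^sub>y)\<^sup>2) *\<^sub>R mat 1)"
    unfolding D_tilde_def obs_gram_def
  proof (rule loewner_ge_gram[OF K])
    fix z :: "real^(3+3)"
    let ?C = "\<lambda>t. C_tilde m (R t) (v t)"
    let ?M = "obs_matrix (\<lambda>t. A_tilde g (R t) (\<Omega> t)) ?C t"
    have up: "upper (?M *v z) = ?C t *v z"
      by (simp add: obs_matrix_def vstack_mult_vec)
    \<comment> \<open>The first two rows of \<open>Delta\<close> are constant unit rows, so the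
      corresponding rows of the derivative block read off the first two components of the lower half
      of \<open>A z\<close>; these are the components of \<open>w\<close> in the estimate.\<close>
    have low: "upper (lower (?M *v z)) $ i = lower (A_tilde g (R t) (\<Omega> t) *v z) $ i"
      if "i = 1 \<or> i = 2" for i
      using that C_tilde_mult_vec(1,2)[of m "R t" "v t" "A_tilde g (R t) (\<Omega> t) *v z"]
        obs_matrix_constant_row[OF C_tilde_differentiable[OF diff] t C_tilde_constant_rows(1)]
        obs_matrix_constant_row[OF C_tilde_differentiable[OF diff] t C_tilde_constant_rows(2)]
      by (auto simp: upper_def)
    show "norm z \<le> (K\<^sub>x + K\<^sub>y) * norm (?M *v z)"
      by (rule norm_le_output[OF R R33 v \<Omega> cases, where X = "upper z"])
        (simp_all add: up low C_tilde_mult_vec lower_A_tilde_mult_vec)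
  qed
  show "loewner_ge (D_bar g m R \<Omega> v t) ((1 / (K\<^sub>x + K\<^sub>y)\<^sup>2) *\<^sub>R mat 1)"
    unfolding D_bar_def obs_gram_def
  proof (rule loewner_ge_gram[OF K])
    fix z :: "real^(3+3)"
    let ?C = "\<lambda>t. C_bar m (R t) (v t)"
    let ?M = "obs_matrix (\<lambda>t. A_bar g (R t) (\<Omega> t)) ?C t"
    have up: "upper (?M *v z) = ?C t *v z"
      by (simp add: obs_matrix_def vstack_mult_vec)
    have low: "upper (lower (?M *v z)) $ i = lower (A_bar g (R t) (\<Omega> t) *v z) $ i"
      if "i = 1 \<or> i = 2" for i
      using that C_bar_mult_vec(1,2)[of m "R t" "v t" "A_bar g (R t) (\<Omega> t) *v z"]
        obs_matrix_constant_row[OF C_bar_differentiable[OF diff] t C_bar_constant_rows(1)]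
        obs_matrix_constant_row[OF C_bar_differentiable[OF diff] t C_bar_constant_rows(2)]
      by (auto simp: upper_def)
    \<comment> \<open>Since \<open>R t\<close> preserves norms, a bound on X =
      \<open>R t *v upper z\<close> is a bound on \<open>upper z\<close>.\<close>
    show "norm z \<le> (K\<^sub>x + K\<^sub>y) * norm (?M *v z)"
      by (rule norm_le_output[OF R R33 v \<Omega> cases, where X = "R t *v upper z"])
        (simp_all add: up low C_bar_mult_vec lower_A_bar_mult_vec[OF R] norm_rotation_mult_vec[OF R])
  qed
qed

end

theorem lemma3:
  fixes R :: "real \<Rightarrow> real^3^3"
    and \<Omega> v v' :: "real \<Rightarrow> real^3"
    and m :: "real^3"
    and g v_max \<Omega>_max \<rho> :: real
  assumes "\<And>t. t \<ge> 0 \<Longrightarrow> rotation_matrix (R t)"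
    and "\<And>t. t \<ge> 0 \<Longrightarrow> (R has_vector_derivative (R t ** skew (\<Omega> t))) (at t within {0..})"
    and "continuous_on {0..} \<Omega>"
    and "\<And>t. t \<ge> 0 \<Longrightarrow> (v has_vector_derivative v' t) (at t within {0..})"
    and "continuous_on {0..} v'"
    and "g > 0"
    and "norm m = 1"
    and "\<not> collinear {0, m, axis 3 1}"
    and "v_max > 0"
    and "\<Omega>_max > 0"
    and "\<And>t. t \<ge> 0 \<Longrightarrow> norm (v t) \<le> v_max"
    and "\<And>t. t \<ge> 0 \<Longrightarrow> norm (\<Omega> t) \<le> \<Omega>_max"
    and "\<rho> > 0"
    and "\<And>t. t \<ge> 0 \<Longrightarrow> \<bar>R t $ 3 $ 3\<bar> \<ge> \<rho>"
    and "(\<forall>t\<ge>0. cross3 (v t) (axis 3 1) = 0) \<or>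
         (\<forall>t\<ge>0. \<Omega> t = 0) \<or>
         v_max * \<Omega>_max \<le> g * \<rho>\<^sup>2 / sqrt 6"
  shows "(\<exists>\<mu>>0. \<forall>t\<ge>0. loewner_ge (D_tilde g m R \<Omega> v t) (\<mu> *\<^sub>R mat 1)) \<and>
         (\<exists>\<mu>>0. \<forall>t\<ge>0. loewner_ge (D_bar g m R \<Omega> v t) (\<mu> *\<^sub>R mat 1))"
proof -
  have "cross3 m (axis 3 1) \<noteq> 0"
    using assms(8) by (simp add: cross_eq_0)
  then interpret static_bounds g \<rho> v_max \<Omega>_max m
    using assms(6,7,9,10,13) by unfold_locales auto
  \<comment> \<open>Both constants depend only on \<open>g\<close>, \<open>\<rho>\<close>,
    \<open>v_max\<close>, \<open>\<Omega>_max\<close> and \<open>m\<close>, so one value serves all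
    times and both parametrizations.\<close>
  let ?\<mu> = "1 / (K\<^sub>x + K\<^sub>y)\<^sup>2"
  have diff: "R differentiable (at t within {0..})" "v differentiable (at t within {0..})"
    if "t \<ge> 0" for t
    using assms(2,4)[OF that] by (auto intro: differentiableI_vector)
  have "loewner_ge (D_tilde g m R \<Omega> v t) (?\<mu> *\<^sub>R mat 1)"
    and "loewner_ge (D_bar g m R \<Omega> v t) (?\<mu> *\<^sub>R mat 1)" if "t \<ge> 0" for t
    using uniform_observability[of t R v \<Omega>, OF that diff[OF that] assms(1)[OF that] assms(14)[OF that]
        assms(11)[OF that] assms(12)[OF that]] assms(15) that by blast+
  moreover have "?\<mu> > 0"
    using constants_pos by simp
  ultimately show ?thesis
    by blast
qed

end
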